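(* There is an absolute constant $C$ such that for every $B\ge 2$ and every input pair of positive integers $(a,b)$ with $a,b\le B$ and $b$ a norm for $\mathbb{Q}(\sqrt[3]{a})/\mathbb{Q}$, the following algorithm terminates after at most $C(\log B)^2$ iterations: (i) Replace $a$ and $b$ by their cube-free parts. If $a>b$ then swap $a$ and $b$. (ii) If $a=0$ or $a=1$ then stop. (iii) Write $b=b_1b_2^2$ with $b_1,b_2$ positive, coprime and square-free. Choose $c\in\mathbb{Z}$ with $a\equiv c^3\pmod{b_1}$. (iv) Let $F(X,Y)=\frac{1}{b_1}\big((cX+b_1Y)^3-aX^3\big)\in\mathbb{Z}[X,Y]$, and find (by reduction theory) integers $u,v$ with $0<F(u,v)<(27/23)^{1/4}(ab_1)^{1/2}$. (v) If $b_2F(u,v)<\frac34 b$ then replace $(a,b)$ by $(a,b_2F(u,v))$ and go to step (i). (vi) Otherwise replace $(a,b)$ by $(b-a,a^2b)$ and go to step (i).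
   Context: The cube-free part of a positive integer $n$ is $n/m^3$ where $m^3$ is the largest cube dividing $n$ (and the cube-free part of $0$ is $0$). An iteration is one pass through steps (i)–(vi). At each step (iii) such $c$ exists and at each step (iv) such $u,v$ exist (the invariant that $b$ is a norm for $\mathbb{Q}(\sqrt[3]{a})/\mathbb{Q}$ is preserved); the claim concerns the number of iterations performed. *)

theory Defs
  imports
    Complex_Main
    "HOL-Algebra.Generated_Fields"
    "HOL-Algebra.Algebraic_Closure_Type"
    "HOL-Computational_Algebra.Squarefree"
    "HOL-Number_Theory.Cong"
begin

text \<open>
  The field obtained by adjoining a cube root of \<open>a\<close> to the rationals is realised inside the
  reals, via the real cube root. A subfield of the reals automatically contains the rationals, so
  generating by the cube root alone suffices.
\<close>

definition pure_cubic_field :: "int \<Rightarrow> real set" where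
  "pure_cubic_field a =
     generate_field (ring_of_type_algebra :: real ring) {root 3 (real_of_int a)}"

text \<open>
  The norm of a number field over the rationals is the product of the conjugates, that is, the
  product over all embeddings into the complex numbers. An embedding of \<open>K\<close> is a function on the
  whole type, so it is pinned to \<open>undefined\<close> outside \<open>K\<close> to be counted once. Ring homomorphisms in
  HOL-Algebra are unital, hence those out of a field are injective and fix the rationals.
\<close>

definition embeddings :: "real set \<Rightarrow> (real \<Rightarrow> complex) set" where
  "embeddings K =
     ring_hom ((ring_of_type_algebra :: real ring)\<lparr>carrier := K\<rparr>)
              (ring_of_type_algebra :: complex ring)
     \<inter> extensional K"

definition field_norm :: "real set \<Rightarrow> real \<Rightarrow> complex" where
  "field_norm K x = (\<Prod>\<sigma>\<in>embeddings K. \<sigma> x)"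

definition is_norm_from :: "real set \<Rightarrow> int \<Rightarrow> bool" where
  "is_norm_from K b \<longleftrightarrow> (\<exists>x\<in>K. field_norm K x = of_int b)"

text \<open>Only used for nonnegative arguments.\<close>

definition cube_free_part :: "int \<Rightarrow> int" where
  "cube_free_part n =
     (if n = 0 then 0 else n div Max {k. (\<exists>m. k = m ^ 3) \<and> k dvd n})"

text \<open>Step (i).\<close>

definition normalise :: "int \<times> int \<Rightarrow> int \<times> int" where
  "normalise = (\<lambda>(a, b).
     let p = cube_free_part a; q = cube_free_part b
     in if p > q then (q, p) else (p, q))"

text \<open>
  The form of step (iv). The division is exact whenever \<open>[a = c ^ 3] (mod b1)\<close>.
\<close>

definition cubic_form :: "int \<Rightarrow> int \<Rightarrow> int \<Rightarrow> int \<Rightarrow> int \<Rightarrow> int" where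
  "cubic_form a b1 c x y = ((c * x + b1 * y) ^ 3 - a * x ^ 3) div b1"

text \<open>
  The choices made in steps (iii) and (iv), for a pair that is already normalised.
\<close>

definition admissible_choice :: "int \<Rightarrow> int \<Rightarrow> int \<Rightarrow> int \<Rightarrow> int \<Rightarrow> int \<Rightarrow> int \<Rightarrow> bool" where
  "admissible_choice a b b1 b2 c u v \<longleftrightarrow>
     b = b1 * b2 ^ 2 \<and> b1 > 0 \<and> b2 > 0 \<and> coprime b1 b2 \<and> squarefree b1 \<and> squarefree b2 \<and>
     [a = c ^ 3] (mod b1) \<and>
     0 < cubic_form a b1 c u v \<and>
     real_of_int (cubic_form a b1 c u v)
       < (27 / 23) powr (1 / 4) * (real_of_int a * real_of_int b1) powr (1 / 2)"

text \<open>
  One pass through the steps. The state \<open>Some (a, b)\<close> means that the algorithm is about to perform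
  step (i) on \<open>(a, b)\<close>, and \<open>None\<close> that it has stopped. The pass that ends by stopping in step (ii)
  is counted as an iteration too. The relation is nondeterministic because it allows every
  admissible choice in steps (iii) and (iv).
\<close>

inductive iteration :: "(int \<times> int) option \<Rightarrow> (int \<times> int) option \<Rightarrow> bool" where
  step_ii:
    "normalise s = (a, b) \<Longrightarrow> a = 0 \<or> a = 1 \<Longrightarrow> iteration (Some s) None"
| step_v:
    "normalise s = (a, b) \<Longrightarrow> \<not> (a = 0 \<or> a = 1) \<Longrightarrow> admissible_choice a b b1 b2 c u v \<Longrightarrow>
     real_of_int (b2 * cubic_form a b1 c u v) < 3 / 4 * real_of_int b \<Longrightarrow>
     iteration (Some s) (Some (a, b2 * cubic_form a b1 c u v))"
| step_vi:
    "normalise s = (a, b) \<Longrightarrow> \<not> (a = 0 \<or> a = 1) \<Longrightarrow> admissible_choice a b b1 b2 c u v \<Longrightarrow>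
     \<not> real_of_int (b2 * cubic_form a b1 c u v) < 3 / 4 * real_of_int b \<Longrightarrow>
     iteration (Some s) (Some (b - a, a ^ 2 * b))"

end

theory Submission
  imports Defs
begin

text \<open>
  Let \<open>p \<le> q\<close> be the normalised pair. Step (v) leaves \<open>p\<close> alone and shrinks \<open>q\<close> by a factor
  \<open>3/4\<close>. Step (vi) is reached only if \<open>q < 100/51 p\<close>, by the bound on \<open>F\<close>, so it shrinks the
  minimum by a factor \<open>49/51\<close>, while the product of the new pair is at most \<open>2 p\<^sup>4\<close>.
  Hence \<open>4 ln (p q) + D ln p\<close> with \<open>D\<close> a suitable multiple of \<open>ln B\<close> drops by at least \<open>1\<close> in every
  iteration, and it is initially \<open>O((ln B)\<^sup>2)\<close>.
\<close>

section \<open>Cube-free parts and normalisation\<close>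

lemma cube_free_part_bounds:
  assumes "n > 0"
  shows "0 < cube_free_part n" "cube_free_part n \<le> n"
proof -
  define S where "S = {k. (\<exists>m. k = m ^ 3) \<and> k dvd n}"
  have "S \<subseteq> {d. d dvd n}" by (auto simp: S_def)
  moreover have "finite {d. d dvd n}" using assms by simp
  ultimately have fin: "finite S" by (rule finite_subset)
  \<comment> \<open>The set also contains negative cubes such as -1; the member 1 makes the maximum
    positive.\<close>
  have one: "1 \<in> S" unfolding S_def by (rule CollectI, rule conjI, rule exI[of _ 1]) simp_all
  have ge: "Max S \<ge> 1" using Max_ge[OF fin one] .
  have "Max S \<in> S" using Max_in[OF fin] one by blast
  then have dvd: "Max S dvd n" by (simp add: S_def)
  then obtain m where m: "n = Max S * m" by (rule dvdE)
  have "cube_free_part n = n div Max S" using assms by (simp add: cube_free_part_def S_def)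
  then have eq: "cube_free_part n = m" using m ge by simp
  have "0 < m" using m ge assms by (simp add: zero_less_mult_iff)
  then show "0 < cube_free_part n" "cube_free_part n \<le> n"
    using eq m ge mult_right_mono[of 1 "Max S" m] by simp_all
qed

lemma normalise_bounds:
  assumes "normalise (a, b) = (p, q)" "a > 0" "b > 0"
  shows "0 < p" "p \<le> q" "p \<le> a" "p \<le> b" "p * q \<le> a * b"
proof -
  note A = cube_free_part_bounds[OF assms(2)] and B = cube_free_part_bounds[OF assms(3)]
  have "cube_free_part a * cube_free_part b \<le> a * b"
    using A B assms by (intro mult_mono) auto
  then show "0 < p" "p \<le> q" "p \<le> a" "p \<le> b" "p * q \<le> a * b"
    using assms(1) A B
    by (auto simp: normalise_def Let_def mult.commute split: if_splits)
qed

text \<open>Covers step (vi) with \<open>b = a\<close>, whose new first entry 0 is excluded by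
  \<open>normalise_bounds\<close>.\<close>

lemma normalise_zero:
  assumes "b > 0"
  shows "normalise (0, b) = (0, cube_free_part b)"
proof -
  have "cube_free_part 0 = 0" by (simp add: cube_free_part_def)
  then show ?thesis using cube_free_part_bounds(1)[OF assms] by (simp add: normalise_def)
qed

section \<open>The potential and its drop in steps (v) and (vi)\<close>

lemma ln_ge_half: "1 / 2 \<le> ln x" if "2 \<le> x" for x :: real
proof -
  have "1 / 2 \<le> ln (2::real)" using ln_le_minus_one[of "1 / 2 :: real"] by (simp add: ln_div)
  also have "\<dots> \<le> ln x" using that by simp
  finally show ?thesis .
qed

text \<open>Used with \<open>L = ln B\<close>. The factor 4 turns
  \<open>ln (3 / 4) \<le> - 1 / 4\<close> into a drop of 1 in step (v). In step (vi),
  \<open>561 * 2 / 51 = 22\<close> pays for the new product term \<open>20 * ln B\<close> and leaves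
  a drop of \<open>2 * ln B\<close>, which is at least 1. The value 0 at \<open>p = 0\<close> fits a
  pair on which the next iteration stops.\<close>

definition potential :: "real \<Rightarrow> int \<times> int \<Rightarrow> real" where
  "potential L = (\<lambda>(p, q). if p = 0 then 0 else 4 * ln (real_of_int (p * q)) + 561 * L * ln (real_of_int p))"

lemma potential_nonneg:
  assumes "0 \<le> p" "p \<le> q" "0 \<le> L"
  shows "0 \<le> potential L (p, q)"
proof (cases "p = 0")
  case False
  then have "1 \<le> p" "1 \<le> p * q" using assms by (auto simp: int_one_le_iff_zero_less)
  then have "1 \<le> real_of_int p" "1 \<le> real_of_int (p * q)" by linarith+
  then show ?thesis using assms by (simp add: potential_def)
qed (simp add: potential_def)

text \<open>Cube-free parts do not increase the product, and the smaller of them is at most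
  \<open>a\<close> even after a swap; so bounds taken before step (i) suffice.\<close>

lemma potential_normalise_le:
  assumes "a > 0" "b > 0" "0 \<le> L" "real_of_int a * real_of_int b \<le> x" "real_of_int a \<le> y"
  shows "potential L (normalise (a, b)) \<le> 4 * ln x + 561 * L * ln y"
proof -
  obtain p q where n: "normalise (a, b) = (p, q)" by (rule prod.exhaust)
  note N = normalise_bounds[OF n assms(1,2)]
  have "0 < p * q" using N by simp
  then have "0 < real_of_int (p * q)" by linarith
  moreover have "real_of_int (p * q) \<le> x"
    using N(5) assms(4) by (metis of_int_le_iff of_int_mult order_trans)
  ultimately have "ln (real_of_int (p * q)) \<le> ln x" by simp
  moreover have "L * ln (real_of_int p) \<le> L * ln y"
    using N assms by (intro mult_left_mono) auto
  ultimately show ?thesis using N by (simp add: n potential_def)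
qed

text \<open>Fourth powers clear both roots; \<open>(51/100)\<^sup>2 < 69/256 = (3/4)\<^sup>4 * 23/27\<close>.\<close>

lemma step_vi_ratio:
  assumes "admissible_choice a b b1 b2 c u v" "0 < a"
    and "\<not> real_of_int (b2 * cubic_form a b1 c u v) < 3 / 4 * real_of_int b"
  shows "51 * b < 100 * a"
proof -
  define F where "F = real_of_int (cubic_form a b1 c u v)"
  define x y z w where "x = real_of_int a" and "y = real_of_int b1" and "z = real_of_int b2"
    and "w = real_of_int b"
  have w: "w = y * z ^ 2" and pos: "x > 0" "y > 0" "z > 0" "F > 0"
    and F: "F < (27 / 23) powr (1 / 4) * (x * y) powr (1 / 2)" and ge: "z * F \<ge> 3 / 4 * w"
    using assms by (auto simp: admissible_choice_def F_def x_def y_def z_def w_def)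
  have "F ^ 4 < ((27 / 23) powr (1 / 4) * (x * y) powr (1 / 2)) ^ 4"
    using F pos by (intro power_strict_mono) auto
  also have "\<dots> = 27 / 23 * (x * y) ^ 2"
    using pos by (simp add: power_mult_distrib powr_power)
  finally have F4: "F ^ 4 < 27 / 23 * (x * y) ^ 2" .
  \<comment> \<open>One factor \<open>w ^ 2\<close> of \<open>w ^ 4\<close> is written as
    \<open>y ^ 2 * z ^ 4\<close>, so that it cancels and only \<open>x\<close> and \<open>w\<close>
    remain.\<close>
  have "(3 / 4) ^ 4 * w ^ 2 * (y ^ 2 * z ^ 4) = (3 / 4 * w) ^ 4"
    by (simp add: w power_mult_distrib power2_eq_square power4_eq_xxxx)
  also have "\<dots> \<le> (z * F) ^ 4" using ge pos w by (intro power_mono) auto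
  also have "\<dots> < z ^ 4 * (27 / 23 * (x * y) ^ 2)"
    using F4 pos by (simp add: power_mult_distrib)
  also have "\<dots> = (27 / 23 * x ^ 2) * (y ^ 2 * z ^ 4)" by (simp add: power_mult_distrib)
  finally have "(3 / 4) ^ 4 * w ^ 2 < 27 / 23 * x ^ 2"
    using pos by (simp add: mult_less_cancel_right)
  then have "(51 * w) ^ 2 < (100 * x) ^ 2"
    using zero_le_power2[of x] by (simp add: power_mult_distrib power4_eq_xxxx, linarith)
  then have "51 * w < 100 * x" by (rule power2_less_imp_less) (use pos in simp)
  then show ?thesis unfolding w_def x_def by linarith
qed

lemma potential_step_v:
  assumes "2 \<le> a" "a \<le> b" "0 < b'" "real_of_int b' < 3 / 4 * real_of_int b" "0 \<le> L"
  shows "potential L (normalise (a, b')) + 1 \<le> potential L (a, b)"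
proof -
  have pos: "real_of_int a > 0" "real_of_int b > 0" using assms by auto
  have "real_of_int a * real_of_int b' \<le> 3 / 4 * real_of_int (a * b)"
    using assms pos by simp
  then have "potential L (normalise (a, b')) \<le> 4 * ln (3 / 4 * real_of_int (a * b)) + 561 * L * ln (real_of_int a)"
    using assms by (intro potential_normalise_le) auto
  also have "ln (3 / 4 * real_of_int (a * b)) = ln (3 / 4) + ln (real_of_int (a * b))"
    using pos by (intro ln_mult_pos) auto
  finally show ?thesis
    using assms ln_le_minus_one[of "3 / 4 :: real"] by (simp add: potential_def algebra_simps)
qed

lemma potential_step_vi:
  assumes "2 \<le> a" "a \<le> b" "51 * b < 100 * a" "real_of_int a \<le> B" "1 / 2 \<le> ln B"
  shows "potential (ln B) (normalise (b - a, a ^ 2 * b)) + 1 \<le> potential (ln B) (a, b)"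
proof -
  define x where "x = real_of_int a"
  have x: "2 \<le> x" "x \<le> B" using assms by (auto simp: x_def)
  have y: "x \<le> real_of_int b" "real_of_int b \<le> 100 / 51 * x" using assms by (auto simp: x_def)
  \<comment> \<open>The product term of the old potential is merely discarded as nonnegative; the
    drop comes from the smaller entry alone.\<close>
  have "4 \<le> x * real_of_int b" using mult_mono[of 2 x 2 "real_of_int b"] x y by simp
  then have "0 \<le> ln (real_of_int (a * b))" by (simp add: x_def)
  then have old: "561 * ln B * ln x \<le> potential (ln B) (a, b)"
    using assms by (simp add: potential_def x_def)
  show ?thesis
  proof (cases "b = a")
    case True
    \<comment> \<open>The new potential is 0 here, so the old one has to be at least 1; it is at
      least \<open>561 / 4\<close>.\<close>
    have "1 / 2 \<le> ln x" using x by (intro ln_ge_half) auto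
    then have "1 / 2 * (1 / 2) \<le> ln B * ln x" using assms by (intro mult_mono) auto
    then show ?thesis using old assms True by (simp add: normalise_zero potential_def)
  next
    case False
    have "real_of_int (b - a) * real_of_int (a ^ 2 * b) \<le> (49 / 51 * x) * (x ^ 2 * (100 / 51 * x))"
    proof (rule mult_mono)
      show "real_of_int (b - a) \<le> 49 / 51 * x" using y by (simp add: x_def)
      have "x ^ 2 * real_of_int b \<le> x ^ 2 * (100 / 51 * x)" using y by (intro mult_left_mono) auto
      then show "real_of_int (a ^ 2 * b) \<le> x ^ 2 * (100 / 51 * x)" by (simp add: x_def)
    qed (use assms x in auto)
    \<comment> \<open>Since \<open>49 * 100 / 51 ^ 2 < 2\<close>; the factor 2 is then absorbed by
      \<open>B\<close>.\<close>
    also have "\<dots> \<le> 2 * x ^ 4" using x by (simp add: power2_eq_square power4_eq_xxxx)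
    also have "\<dots> \<le> B * B ^ 4" using x by (intro mult_mono power_mono) auto
    also have "\<dots> = B ^ 5" by (simp add: eval_nat_numeral)
    finally have "potential (ln B) (normalise (b - a, a ^ 2 * b)) \<le> 4 * ln (B ^ 5) + 561 * ln B * ln (49 / 51 * x)"
      using assms False y by (intro potential_normalise_le) (auto simp: x_def)
    also have "\<dots> \<le> 20 * ln B + 561 * ln B * (ln x - 2 / 51)"
    proof -
      have "ln (49 / 51 * x) = ln (49 / 51) + ln x" using x by (intro ln_mult_pos) auto
      then have "ln (49 / 51 * x) \<le> ln x - 2 / 51"
        using ln_le_minus_one[of "49 / 51 :: real"] by simp
      then have "ln B * ln (49 / 51 * x) \<le> ln B * (ln x - 2 / 51)"
        using assms by (intro mult_left_mono) auto
      moreover have "ln (B ^ 5) = 5 * ln B" using x by (simp add: ln_realpow)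
      ultimately show ?thesis by linarith
    qed
    also have "\<dots> = 561 * ln B * ln x - 2 * ln B" by (simp add: algebra_simps)
    finally show ?thesis using old assms by linarith
  qed
qed

section \<open>Counting iterations\<close>

lemma iteration_None: "\<not> iteration None t"
  by (auto elim: iteration.cases)

text \<open>Each pass that does not stop lowers a nonnegative potential by 1; the extra 1 counts the
  stopping pass of step (ii). One fixed \<open>B\<close> serves throughout because the smaller entry
  never grows, although the larger one may exceed \<open>B\<close>.\<close>

lemma iteration_count:
  assumes "(iteration ^^ n) (Some s) t" "normalise s = (p, q)" "0 \<le> p" "p \<le> q"
    "real_of_int p \<le> B" "1 / 2 \<le> ln B"
  shows "real n \<le> potential (ln B) (p, q) + 1"
  using assms
proof (induction n arbitrary: s p q)
  case 0
  then show ?case using potential_nonneg[of p q "ln B"] by simp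
next
  case (Suc n)
  obtain s' where step: "iteration (Some s) s'" and rest: "(iteration ^^ n) s' t"
    using relpowp_Suc_D2[OF Suc.prems(1)] by blast
  show ?case
  proof (cases s')
    case None
    then have "n = 0" using rest iteration_None by (cases n) (auto dest!: relpowp_Suc_D2 simp del: relpowp.simps)
    then show ?thesis using potential_nonneg[of p q "ln B"] Suc.prems by simp
  next
    case (Some r)
    obtain p' q' where n': "normalise r = (p', q')" by fastforce
    have "0 \<le> p' \<and> p' \<le> q' \<and> p' \<le> p \<and> potential (ln B) (p', q') + 1 \<le> potential (ln B) (p, q)"
      using step
    proof cases
      case (step_v a b b1 b2 c u v)
      define b' where "b' = b2 * cubic_form a b1 c u v"
      have "b' > 0" using step_v by (simp add: b'_def admissible_choice_def)
      then show ?thesis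
        using step_v Suc.prems Some n' normalise_bounds[of a b' p' q']
          potential_step_v[of a b b' "ln B"] by (auto simp: b'_def)
    next
      case (step_vi a b b1 b2 c u v)
      have *: "2 \<le> a" "a \<le> b" "real_of_int a \<le> B" using step_vi Suc.prems by auto
      have ratio: "51 * b < 100 * a" using step_vi_ratio[of a b b1 b2 c u v] step_vi * by simp
      note pot = potential_step_vi[OF *(1,2) ratio *(3) Suc.prems(6)]
      have r: "r = (b - a, a ^ 2 * b)" and pq: "p = a" "q = b" using step_vi Suc.prems Some by auto
      show ?thesis
      proof (cases "b = a")
        case True
        then have "normalise r = (0, cube_free_part (a ^ 2 * b))"
          using r * normalise_zero[of "a ^ 2 * b"] by simp
        then show ?thesis
          using pot n' r pq * True cube_free_part_bounds[of "a ^ 2 * b"] by auto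
      next
        case False
        then show ?thesis
          using pot n' r pq * ratio normalise_bounds[of "b - a" "a ^ 2 * b" p' q'] by auto
      qed
    qed (use Some in simp)
    moreover have "real n \<le> potential (ln B) (p', q') + 1"
      using Suc.IH[OF rest[unfolded Some] n'] calculation Suc.prems by auto
    ultimately show ?thesis by simp
  qed
qed

lemma iteration_count_le:
  assumes "B \<ge> 2" "a > 0" "b > 0" "real_of_int a \<le> B" "real_of_int b \<le> B"
    and "(iteration ^^ n) (Some (a, b)) s"
  shows "real n \<le> 600 * (ln B) ^ 2"
proof -
  obtain p q where n: "normalise (a, b) = (p, q)" by (rule prod.exhaust)
  note N = normalise_bounds[OF n assms(2,3)]
  note L = ln_ge_half[OF assms(1)]
  have "real_of_int a * real_of_int b \<le> B ^ 2"
    using assms by (auto simp: power2_eq_square intro!: mult_mono)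
  then have "potential (ln B) (p, q) \<le> 4 * ln (B ^ 2) + 561 * ln B * ln B"
    using potential_normalise_le[of a b "ln B"] assms L n by auto
  also have "\<dots> = 8 * ln B + 561 * (ln B) ^ 2"
    using assms by (simp add: ln_realpow power2_eq_square[of "ln B"])
  finally have "real n \<le> 8 * ln B + 561 * (ln B) ^ 2 + 1"
    using iteration_count[OF assms(6) n, of B] N L assms by auto
  \<comment> \<open>With \<open>1 / 2 \<le> ln B\<close>, the terms \<open>8 * ln B + 1\<close> are
    at most \<open>20 * (ln B) ^ 2\<close>, and \<open>561 + 20 < 600\<close>.\<close>
  moreover have "1 / 2 * ln B \<le> (ln B) ^ 2"
    using L unfolding power2_eq_square by (intro mult_right_mono) auto
  ultimately show ?thesis using L by linarith
qed

theorem theorem3p7: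
  shows "\<exists>C::real. \<forall>(B::real) (a::int) (b::int).
    B \<ge> 2 \<longrightarrow> a > 0 \<longrightarrow> b > 0 \<longrightarrow> real_of_int a \<le> B \<longrightarrow> real_of_int b \<le> B \<longrightarrow>
    is_norm_from (pure_cubic_field a) b \<longrightarrow>
      (\<forall>n s. (iteration ^^ n) (Some (a, b)) s \<longrightarrow> real n \<le> C * (ln B) ^ 2) \<and>
      (\<forall>\<sigma>. \<sigma> 0 = Some (a, b) \<and> (\<forall>i. \<sigma> i \<noteq> None \<longrightarrow> iteration (\<sigma> i) (\<sigma> (Suc i))) \<longrightarrow>
         (\<exists>n::nat. real n \<le> C * (ln B) ^ 2 \<and> \<sigma> n = None))"
proof (rule exI[of _ 600], intro allI impI conjI)
  fix B :: real and a b :: int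
  assume *: "B \<ge> 2" "a > 0" "b > 0" "real_of_int a \<le> B" "real_of_int b \<le> B"
  show "real n \<le> 600 * (ln B) ^ 2" if "(iteration ^^ n) (Some (a, b)) s" for n s
    using iteration_count_le[OF * that] .
  fix \<sigma> :: "nat \<Rightarrow> (int \<times> int) option"
  assume \<sigma>: "\<sigma> 0 = Some (a, b) \<and> (\<forall>i. \<sigma> i \<noteq> None \<longrightarrow> iteration (\<sigma> i) (\<sigma> (Suc i)))"
  show "\<exists>n::nat. real n \<le> 600 * (ln B) ^ 2 \<and> \<sigma> n = None"
  proof (rule ccontr)
    assume none: "\<nexists>n::nat. real n \<le> 600 * (ln B) ^ 2 \<and> \<sigma> n = None"
    \<comment> \<open>A run that has not stopped by time \<open>N\<close> makes \<open>Suc N\<close>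
      genuine iterations, one more than the count allows.\<close>
    define N where "N = nat \<lfloor>600 * (ln B) ^ 2\<rfloor>"
    have N: "real N \<le> 600 * (ln B) ^ 2" "600 * (ln B) ^ 2 < real (Suc N)"
      by (simp add: N_def) (simp add: N_def, linarith)
    have "iteration (\<sigma> i) (\<sigma> (Suc i))" if "i < Suc N" for i
    proof -
      have "real i \<le> 600 * (ln B) ^ 2" using that N(1) by linarith
      then show ?thesis using none \<sigma> by blast
    qed
    then have "(iteration ^^ Suc N) (\<sigma> 0) (\<sigma> (Suc N))"
      by (auto simp only: relpowp_fun_conv)
    then have "(iteration ^^ Suc N) (Some (a, b)) (\<sigma> (Suc N))" using \<sigma> by simp
    then show False using iteration_count_le[OF *] N(2) by (meson not_less)
  qed
qed

end
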